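(* Let $\Phi = (A; \{E_i\}_{i=0}^d; A^*; \{E^*_i\}_{i=0}^d)$ be a self-dual Leonard system on $V$, and let $T = \sum_{i=0}^d \eta_{d-i}(A) E^*_0 E_d \tau^*_i(A^* )$. Then the following hold for the decompositions $[zw]$ of $V$: $$T[0^*D]=[0D^*],\quad T[D^*D]=[DD^*],\quad T[0^*0]=[00^*],\quad T[D^*0]=[D0^*],\quad T[0D]=[0^*D^*],\quad T[0^*D^*]=[0D].$$
   Context: Let $\mathbb{F}$ be a field and $V$ a vector space over $\mathbb{F}$ with finite positive dimension; $\mathrm{End}(V)$ is the $\mathbb{F}$-algebra of $\mathbb{F}$-linear maps $V\to V$. A square matrix is tridiagonal if each nonzero entry lies on the diagonal, subdiagonal or superdiagonal; a tridiagonal matrix is irreducible if every subdiagonal entry and every superdiagonal entry is nonzero. A Leonard pair on $V$ is an ordered pair $A, A^*$ of elements of $\mathrm{End}(V)$ (the symbol $A^*$ does not denote an adjoint) such that (i) there is a basis of $V$ with respect to which $A$ is represented by an irreducible tridiagonal matrix and $A^*$ by a diagonal matrix; (ii) there is a basis of $V$ with respect to which $A^*$ is represented by an irreducible tridiagonal matrix and $A$ by a diagonal matrix. For a Leonard pair each of $A$, $A^*$ is multiplicity-free (diagonalizable with all eigenspaces of dimension one). For a multiplicity-free element, its primitive idempotents are the projections onto its eigenspaces (identity on one eigenspace, zero on the others). An ordering $\{E_i\}_{i=0}^d$ of the primitive idempotents of $A$ is standard if, for $0\neq v_i\in E_iV$, the matrix representing $A^*$ with respect to the basis $\{v_i\}_{i=0}^d$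 is irreducible tridiagonal; a standard ordering of the primitive idempotents of $A^*$ is defined similarly with the roles of $A,A^*$ swapped. A Leonard system on $V$ is a sequence $\Phi=(A;\{E_i\}_{i=0}^d;A^*;\{E_i^*\}_{i=0}^d)$ where $A,A^*$ is a Leonard pair on $V$ and $\{E_i\}_{i=0}^d$, $\{E^*_i\}_{i=0}^d$ are standard orderings of the primitive idempotents of $A$, $A^*$ respectively (so $\dim V=d+1$). Let $\theta_i$ (resp. $\theta^*_i$) be the eigenvalue of $A$ (resp. $A^*$) corresponding to $E_i$ (resp. $E_i^*$). $\Phi$ is self-dual if there is an $\mathbb{F}$-algebra automorphism $\sigma$ of $\mathrm{End}(V)$ sending $A\mapsto A^*$, $A^*\mapsto A$, $E_i\mapsto E^*_i$, $E_i^*\mapsto E_i$ $(0\le i\le d)$. For $0\le i\le d$ define polynomials $\eta_i=(x-\theta_d)(x-\theta_{d-1})\cdots(x-\theta_{d-i+1})$ and $\tau_i^*=(x-\theta^*_0)\cdots(x-\theta^*_{i-1})$ (empty products are $1$). A flag on $V$ is a sequence $\{H_i\}_{i=0}^d$ of subspaces with $\dim H_i=i+1$ $(0\le i\le d)$ and $H_{i-1}\subseteq H_i$ $(1\le i\le d)$. A decomposition of $V$ is a sequence $\{V_i\}_{i=0}^d$ of one-dimensional subspaces whose direct sum is $V$; it induces the flag $\{V_0+\cdots+V_i\}_{i=0}^d$. Two flags $\{H_i\}$, $\{H'_i\}$ are opposite if there is a decomposition $\{V_i\}_{i=0}^d$ such that $\{V_i\}_{i=0}^d$ induces $\{H_i\}$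 and $\{V_{d-i}\}_{i=0}^d$ induces $\{H'_i\}$; then $V_i=H_i\cap H'_{d-i}$ $(0\le i\le d)$, and $\{V_i\}_{i=0}^d$ is called the decomposition induced by the ordered pair $\{H_i\},\{H'_i\}$. The flags $[0],[D],[0^*],[D^*]$ have $i$-th components $(0\le i\le d)$: $E_0V+\cdots+E_iV$ for $[0]$; $E_dV+E_{d-1}V+\cdots+E_{d-i}V$ for $[D]$; $E^*_0V+\cdots+E^*_iV$ for $[0^*]$; $E^*_dV+E^*_{d-1}V+\cdots+E^*_{d-i}V$ for $[D^*]$. It is known that these four flags are mutually opposite. For distinct $z,w\in\{0,D,0^*,D^*\}$, $[zw]$ denotes the decomposition of $V$ induced by the ordered pair $[z],[w]$, so its $i$-th component is the intersection of the $i$-th component of $[z]$ and the $(d-i)$-th component of $[w]$. For a sequence $H=\{H_i\}_{i=0}^d$ of subspaces of $V$, $TH$ denotes $\{TH_i\}_{i=0}^d$. *)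

theory Defs
  imports
    "HOL-Computational_Algebra.Polynomial"
    "HOL-Library.FuncSet"
    "HOL-Library.Set_Algebras"
begin

text \<open>
  Sequences indexed by \<open>0, \<dots>, d\<close> are functions on \<^typ>\<open>nat\<close> of which only the values at
  indices \<open>\<le> d\<close> matter; likewise a \<open>(d+1) \<times> (d+1)\<close> matrix is a function
  \<open>nat \<Rightarrow> nat \<Rightarrow> 'a\<close>, first argument the row. The space \<open>V\<close> is the whole type \<open>'b\<close>.
\<close>

definition diagonal_upto :: "nat \<Rightarrow> (nat \<Rightarrow> nat \<Rightarrow> 'a::zero) \<Rightarrow> bool" where
  "diagonal_upto d B \<longleftrightarrow> (\<forall>i\<le>d. \<forall>j\<le>d. i \<noteq> j \<longrightarrow> B i j = 0)"

definition tridiagonal_upto :: "nat \<Rightarrow> (nat \<Rightarrow> nat \<Rightarrow> 'a::zero) \<Rightarrow> bool" where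
  "tridiagonal_upto d B \<longleftrightarrow>
     (\<forall>i\<le>d. \<forall>j\<le>d. B i j \<noteq> 0 \<longrightarrow> i = j \<or> i = Suc j \<or> j = Suc i)"

definition irreducible_tridiagonal_upto :: "nat \<Rightarrow> (nat \<Rightarrow> nat \<Rightarrow> 'a::zero) \<Rightarrow> bool" where
  "irreducible_tridiagonal_upto d B \<longleftrightarrow>
     tridiagonal_upto d B \<and> (\<forall>i<d. B (Suc i) i \<noteq> 0 \<and> B i (Suc i) \<noteq> 0)"

definition eta_poly :: "nat \<Rightarrow> (nat \<Rightarrow> 'a::comm_ring_1) \<Rightarrow> nat \<Rightarrow> 'a poly" where
  "eta_poly d \<theta> i = (\<Prod>k<i. [:- \<theta> (d - k), 1:])"

definition tau_poly :: "(nat \<Rightarrow> 'a::comm_ring_1) \<Rightarrow> nat \<Rightarrow> 'a poly" where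
  "tau_poly \<theta> i = (\<Prod>k<i. [:- \<theta> k, 1:])"

text \<open>The sum of sets is the Minkowski sum of \<^theory>\<open>HOL-Library.Set_Algebras\<close>,
  which for subspaces is the sum of subspaces.\<close>

definition induced_flag :: "(nat \<Rightarrow> 'b::comm_monoid_add set) \<Rightarrow> nat \<Rightarrow> 'b set" where
  "induced_flag V i = (\<Sum>j\<le>i. V j)"

text \<open>The labels \<open>0, D, 0*, D*\<close> of the four flags.\<close>

datatype flag_label = L0 | LD | L0s | LDs

fun flag_of ::
  "nat \<Rightarrow> (nat \<Rightarrow> 'b \<Rightarrow> 'b) \<Rightarrow> (nat \<Rightarrow> 'b \<Rightarrow> 'b) \<Rightarrow> flag_label \<Rightarrow> nat \<Rightarrow> 'b::comm_monoid_add set"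
where
  "flag_of d E Es L0 = induced_flag (\<lambda>j. range (E j))"
| "flag_of d E Es LD = induced_flag (\<lambda>j. range (E (d - j)))"
| "flag_of d E Es L0s = induced_flag (\<lambda>j. range (Es j))"
| "flag_of d E Es LDs = induced_flag (\<lambda>j. range (Es (d - j)))"

text \<open>A copy of \<^locale>\<open>vector_space\<close>, so that the definitions below are not also
  instantiated (and shadowed) by the global interpretation for real vector spaces.\<close>

locale linear_algebra_space = vector_space scale
  for scale :: "'a::field \<Rightarrow> 'b::ab_group_add \<Rightarrow> 'b" (infixr \<open>*s\<close> 75)
begin

definition End :: "('b \<Rightarrow> 'b) set" where
  "End = {f. Vector_Spaces.linear scale scale f}"

definition End_automorphism :: "(('b \<Rightarrow> 'b) \<Rightarrow> ('b \<Rightarrow> 'b)) \<Rightarrow> bool" where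
  "End_automorphism \<sigma> \<longleftrightarrow>
     bij_betw \<sigma> End End \<and>
     (\<forall>f\<in>End. \<forall>g\<in>End. \<sigma> (\<lambda>x. f x + g x) = (\<lambda>x. \<sigma> f x + \<sigma> g x)) \<and>
     (\<forall>c. \<forall>f\<in>End. \<sigma> (\<lambda>x. c *s f x) = (\<lambda>x. c *s \<sigma> f x)) \<and>
     (\<forall>f\<in>End. \<forall>g\<in>End. \<sigma> (f \<circ> g) = \<sigma> f \<circ> \<sigma> g) \<and>
     \<sigma> id = id"

definition indexed_basis :: "nat \<Rightarrow> (nat \<Rightarrow> 'b) \<Rightarrow> bool" where
  "indexed_basis d v \<longleftrightarrow>
     inj_on v {..d} \<and> independent (v ` {..d}) \<and> span (v ` {..d}) = UNIV"

text \<open>Column \<open>j\<close> holds the coordinates of \<open>X v\<^sub>j\<close>; meaningful only if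
  \<open>indexed_basis d v\<close>.\<close>

definition matrix_wrt :: "nat \<Rightarrow> (nat \<Rightarrow> 'b) \<Rightarrow> ('b \<Rightarrow> 'b) \<Rightarrow> nat \<Rightarrow> nat \<Rightarrow> 'a" where
  "matrix_wrt d v X i j = representation (v ` {..d}) (X (v j)) (v i)"

definition leonard_pair :: "('b \<Rightarrow> 'b) \<Rightarrow> ('b \<Rightarrow> 'b) \<Rightarrow> bool" where
  "leonard_pair A As \<longleftrightarrow>
     A \<in> End \<and> As \<in> End \<and>
     (\<exists>d v. indexed_basis d v \<and> irreducible_tridiagonal_upto d (matrix_wrt d v A)
        \<and> diagonal_upto d (matrix_wrt d v As)) \<and>
     (\<exists>d v. indexed_basis d v \<and> irreducible_tridiagonal_upto d (matrix_wrt d v As)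
        \<and> diagonal_upto d (matrix_wrt d v A))"

definition eigenspace :: "('b \<Rightarrow> 'b) \<Rightarrow> 'a \<Rightarrow> 'b set" where
  "eigenspace X t = {x. X x = t *s x}"

definition eigenvalue :: "('b \<Rightarrow> 'b) \<Rightarrow> 'a \<Rightarrow> bool" where
  "eigenvalue X t \<longleftrightarrow> (\<exists>x\<in>eigenspace X t. x \<noteq> 0)"

text \<open>\<open>P\<close> is the projection onto the \<open>t\<close>-eigenspace of \<open>X\<close>. It is unique for
  diagonalizable \<open>X\<close>, in particular for the members of a Leonard pair, which are
  multiplicity-free.\<close>

definition primitive_idempotent_at :: "('b \<Rightarrow> 'b) \<Rightarrow> 'a \<Rightarrow> ('b \<Rightarrow> 'b) \<Rightarrow> bool" where
  "primitive_idempotent_at X t P \<longleftrightarrow>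
     eigenvalue X t \<and> P \<in> End \<and>
     (\<forall>x\<in>eigenspace X t. P x = x) \<and>
     (\<forall>s. s \<noteq> t \<longrightarrow> (\<forall>x\<in>eigenspace X s. P x = 0))"

definition primitive_idempotents :: "('b \<Rightarrow> 'b) \<Rightarrow> ('b \<Rightarrow> 'b) set" where
  "primitive_idempotents X = {P. \<exists>t. primitive_idempotent_at X t P}"

definition eigenvalue_of :: "('b \<Rightarrow> 'b) \<Rightarrow> ('b \<Rightarrow> 'b) \<Rightarrow> 'a" where
  "eigenvalue_of X P = (THE t. primitive_idempotent_at X t P)"

definition standard_ordering ::
  "nat \<Rightarrow> ('b \<Rightarrow> 'b) \<Rightarrow> (nat \<Rightarrow> 'b \<Rightarrow> 'b) \<Rightarrow> ('b \<Rightarrow> 'b) \<Rightarrow> bool" where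
  "standard_ordering d A E As \<longleftrightarrow>
     bij_betw E {..d} (primitive_idempotents A) \<and>
     (\<forall>v. (\<forall>i\<le>d. v i \<in> range (E i) \<and> v i \<noteq> 0) \<longrightarrow>
        irreducible_tridiagonal_upto d (matrix_wrt d v As))"

definition leonard_system ::
  "nat \<Rightarrow> ('b \<Rightarrow> 'b) \<Rightarrow> (nat \<Rightarrow> 'b \<Rightarrow> 'b) \<Rightarrow> ('b \<Rightarrow> 'b) \<Rightarrow> (nat \<Rightarrow> 'b \<Rightarrow> 'b) \<Rightarrow> bool" where
  "leonard_system d A E As Es \<longleftrightarrow>
     leonard_pair A As \<and> standard_ordering d A E As \<and> standard_ordering d As Es A"

definition self_dual ::
  "nat \<Rightarrow> ('b \<Rightarrow> 'b) \<Rightarrow> (nat \<Rightarrow> 'b \<Rightarrow> 'b) \<Rightarrow> ('b \<Rightarrow> 'b) \<Rightarrow> (nat \<Rightarrow> 'b \<Rightarrow> 'b) \<Rightarrow> bool" where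
  "self_dual d A E As Es \<longleftrightarrow>
     (\<exists>\<sigma>. End_automorphism \<sigma> \<and> \<sigma> A = As \<and> \<sigma> As = A \<and>
        (\<forall>i\<le>d. \<sigma> (E i) = Es i \<and> \<sigma> (Es i) = E i))"

definition poly_map :: "'a poly \<Rightarrow> ('b \<Rightarrow> 'b) \<Rightarrow> 'b \<Rightarrow> 'b" where
  "poly_map p X x = (\<Sum>k\<le>degree p. coeff p k *s (X ^^ k) x)"

definition duality_map ::
  "nat \<Rightarrow> ('b \<Rightarrow> 'b) \<Rightarrow> (nat \<Rightarrow> 'b \<Rightarrow> 'b) \<Rightarrow> ('b \<Rightarrow> 'b) \<Rightarrow> (nat \<Rightarrow> 'b \<Rightarrow> 'b) \<Rightarrow> 'b \<Rightarrow> 'b" where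
  "duality_map d A E As Es x =
     (\<Sum>i\<le>d.
        (poly_map (eta_poly d (\<lambda>k. eigenvalue_of A (E k)) (d - i)) A
         \<circ> Es 0 \<circ> E d
         \<circ> poly_map (tau_poly (\<lambda>k. eigenvalue_of As (Es k)) i) As) x)"

definition decomposition :: "nat \<Rightarrow> (nat \<Rightarrow> 'b set) \<Rightarrow> bool" where
  "decomposition d V \<longleftrightarrow>
     (\<forall>i\<le>d. subspace (V i) \<and> dim (V i) = 1) \<and>
     (\<forall>x. \<exists>!u. u \<in> (\<Pi>\<^sub>E i\<in>{..d}. V i) \<and> (\<Sum>i\<le>d. u i) = x)"

definition induces_flags ::
  "nat \<Rightarrow> (nat \<Rightarrow> 'b set) \<Rightarrow> (nat \<Rightarrow> 'b set) \<Rightarrow> (nat \<Rightarrow> 'b set) \<Rightarrow> bool" where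
  "induces_flags d V H H' \<longleftrightarrow>
     decomposition d V \<and>
     (\<forall>i\<le>d. induced_flag V i = H i) \<and>
     (\<forall>i\<le>d. induced_flag (\<lambda>j. V (d - j)) i = H' i)"

text \<open>For opposite flags the choice below exists and is determined at all indices \<open>i \<le> d\<close>,
  namely as \<open>H i \<inter> H' (d - i)\<close>.\<close>

definition induced_decomposition ::
  "nat \<Rightarrow> (nat \<Rightarrow> 'b set) \<Rightarrow> (nat \<Rightarrow> 'b set) \<Rightarrow> nat \<Rightarrow> 'b set" where
  "induced_decomposition d H H' = (SOME V. induces_flags d V H H')"

text \<open>The decomposition \<open>[zw]\<close>.\<close>

definition decomp ::
  "nat \<Rightarrow> (nat \<Rightarrow> 'b \<Rightarrow> 'b) \<Rightarrow> (nat \<Rightarrow> 'b \<Rightarrow> 'b) \<Rightarrow> flag_label \<Rightarrow> flag_label \<Rightarrow> nat \<Rightarrow> 'b set" where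
  "decomp d E Es z w = induced_decomposition d (flag_of d E Es z) (flag_of d E Es w)"

end

end

theory Submission
  imports Defs
begin

text \<open>
  A Leonard system is encoded by two ordered bases: \<open>e\<close>, consisting of eigenvectors of \<open>A\<close>, and
  \<open>f\<close>, consisting of eigenvectors of \<open>As\<close>, such that \<open>As\<close> is irreducible tridiagonal in \<open>e\<close> and \<open>A\<close> is
  irreducible tridiagonal in \<open>f\<close> (lemma \<open>standard_ordering_eigenbasis\<close>).

  The automorphism \<open>\<sigma>\<close> that makes the system self-dual is conjugation by an invertible linear map
  \<open>S\<close>, which can be normalized by \<open>S (e 0) = f 0\<close> (lemma \<open>automorphism_intertwiner\<close>). Since
  \<open>\<sigma>\<close> exchanges \<open>E i\<close> and \<open>Es i\<close>, the map \<open>S\<close> exchanges their ranges. The heart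
  of the proof is that \<open>T\<close> is a nonzero scalar multiple of \<open>S\<close> (lemma
  \<open>duality_map_multiple_of_intertwiner\<close>): evaluated on the vectors \<open>\<eta>\<^sub>d\<^sub>-\<^sub>j(As) (e 0)\<close>, only the term
  of index \<open>j\<close> in the sum defining \<open>T\<close> survives, and the scalar it produces is the coefficient of
  \<open>e d\<close> in the image of \<open>e 0\<close> under a monic polynomial of degree \<open>d\<close> in \<open>As\<close>. By tridiagonality
  this coefficient does not depend on the polynomial.

  Consequently \<open>T\<close> is invertible and exchanges the flags \<open>[0]\<close> and \<open>[0\<^sup>*]\<close>, and likewise \<open>[D]\<close> and
  \<open>[D\<^sup>*]\<close>. Component \<open>i\<close> of \<open>[zw]\<close> is the intersection of component \<open>i\<close> of \<open>[z]\<close> with component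
  \<open>d - i\<close> of \<open>[w]\<close> (lemma \<open>induced_decomposition_inter\<close>), and an injective map commutes with
  intersections. The last step requires that the four flags are mutually opposite (lemma
  \<open>flags_mutually_opposite\<close>); this comes from the vectors \<open>\<tau>\<^sub>i(A) (f 0)\<close>, which are triangular with
  respect to \<open>f\<close> and to \<open>e\<close> in opposite directions.
\<close>

section \<open>Endomorphisms and coordinates\<close>

lemma degree_prod_monic_linear:
  fixes g :: "'i \<Rightarrow> 'a::field"
  assumes "finite I"
  shows "degree (\<Prod>k\<in>I. [:- g k, 1:]) = card I"
  using assms by (subst degree_prod_eq_sum_degree) auto

lemma lead_coeff_prod_monic_linear:
  fixes g :: "'i \<Rightarrow> 'a::field"
  shows "lead_coeff (\<Prod>k\<in>I. [:- g k, 1:]) = 1"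
  by (simp add: lead_coeff_prod)

context linear_algebra_space
begin

lemma End_iff:
  "X \<in> End \<longleftrightarrow> (\<forall>x y. X (x + y) = X x + X y) \<and> (\<forall>c x. X (c *s x) = c *s X x)"
  unfolding End_def Vector_Spaces.linear_iff using vector_space_axioms by auto

lemma End_add: "X \<in> End \<Longrightarrow> X (x + y) = X x + X y"
  and End_scale: "X \<in> End \<Longrightarrow> X (c *s x) = c *s X x"
  by (auto simp: End_iff)

lemma End_zero: "X \<in> End \<Longrightarrow> X 0 = 0"
  by (metis End_add add_cancel_right_right)

lemma End_sum: "X \<in> End \<Longrightarrow> X (sum g I) = (\<Sum>i\<in>I. X (g i))"
  by (induction I rule: infinite_finite_induct) (auto simp: End_zero End_add)

definition coord :: "nat \<Rightarrow> (nat \<Rightarrow> 'b) \<Rightarrow> 'b \<Rightarrow> nat \<Rightarrow> 'a" where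
  "coord d e x i = representation (e ` {..d}) x (e i)"

lemma matrix_wrt_coord: "matrix_wrt d e X i j = coord d e (X (e j)) i"
  by (simp add: matrix_wrt_def coord_def)

lemma coord_expand: "indexed_basis d e \<Longrightarrow> (\<Sum>i\<le>d. coord d e x i *s e i) = x"
  unfolding coord_def indexed_basis_def
  using sum_representation_eq[of "e ` {..d}" x "e ` {..d}"]
  by (simp add: sum.reindex)

lemma coord_add: "indexed_basis d e \<Longrightarrow> coord d e (x + y) i = coord d e x i + coord d e y i"
  unfolding coord_def indexed_basis_def by (simp add: representation_add)

lemma coord_scale: "indexed_basis d e \<Longrightarrow> coord d e (c *s x) i = c * coord d e x i"
  unfolding coord_def indexed_basis_def by (simp add: representation_scale)

lemma coord_zero: "coord d e 0 i = 0"
  by (simp add: coord_def representation_zero)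

lemma coord_sum: "indexed_basis d e \<Longrightarrow> coord d e (sum g I) i = (\<Sum>k\<in>I. coord d e (g k) i)"
  by (induction I rule: infinite_finite_induct) (auto simp: coord_zero coord_add)

lemma coord_basis:
  assumes "indexed_basis d e" "i \<le> d" "j \<le> d"
  shows "coord d e (e j) i = (if i = j then 1 else 0)"
  using assms unfolding coord_def indexed_basis_def
  by (auto simp: representation_basis inj_on_def)

lemma coord_combination:
  assumes "indexed_basis d e" "i \<le> d"
  shows "coord d e (\<Sum>j\<le>d. a j *s e j) i = a i"
proof -
  have "coord d e (\<Sum>j\<le>d. a j *s e j) i = (\<Sum>j\<le>d. a j * coord d e (e j) i)"
    using assms(1) by (simp add: coord_sum coord_scale)
  also have "\<dots> = (\<Sum>j\<le>d. if i = j then a j else 0)"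
    using assms by (intro sum.cong) (auto simp: coord_basis)
  finally show ?thesis
    using assms(2) by simp
qed

lemma coord_eqI:
  assumes "indexed_basis d e" "\<And>i. i \<le> d \<Longrightarrow> coord d e x i = coord d e y i"
  shows "x = y"
proof -
  have "(\<Sum>i\<le>d. coord d e x i *s e i) = (\<Sum>i\<le>d. coord d e y i *s e i)"
    using assms(2) by (intro sum.cong) auto
  then show ?thesis
    using assms(1) by (simp add: coord_expand)
qed

lemma indexed_basis_nonzero: "indexed_basis d e \<Longrightarrow> i \<le> d \<Longrightarrow> e i \<noteq> 0"
  using coord_basis[of d e i i] by (auto simp: coord_zero)

lemma coord_End:
  assumes e: "indexed_basis d e" and X: "X \<in> End"
  shows "coord d e (X x) i = (\<Sum>j\<le>d. matrix_wrt d e X i j * coord d e x j)"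
proof -
  have "X x = (\<Sum>j\<le>d. coord d e x j *s X (e j))"
    using X by (subst coord_expand[OF e, of x, symmetric]) (simp add: End_sum End_scale)
  then show ?thesis
    using e by (simp add: coord_sum coord_scale matrix_wrt_coord mult.commute)
qed

lemma indexed_basis_dim:
  assumes "indexed_basis d e"
  shows "dim (UNIV :: 'b set) = Suc d"
  using assms dim_eq_card[of "e ` {..d}" UNIV]
  by (simp add: indexed_basis_def card_image)

lemma indexed_basis_finite_dimensional:
  "indexed_basis d e \<Longrightarrow> finite_dimensional_vector_space scale (e ` {..d})"
  by unfold_locales (auto simp: indexed_basis_def)

lemma spanning_family_is_basis:
  assumes e: "indexed_basis d e" and u: "span (u ` {..d}) = UNIV"
  shows "indexed_basis d u"
proof -
  interpret finite_dimensional_vector_space scale "e ` {..d}"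
    using e by (rule indexed_basis_finite_dimensional)
  have dim: "dim (UNIV :: 'b set) = Suc d"
    using e by (rule indexed_basis_dim)
  have "Suc d \<le> card (u ` {..d})"
    using span_card_ge_dim[of "u ` {..d}" UNIV] u dim by simp
  then have card: "card (u ` {..d}) = Suc d"
    using card_image_le[of "{..d}" u] by simp
  then have "inj_on u {..d}"
    by (intro eq_card_imp_inj_on) auto
  moreover have "independent (u ` {..d})"
    using u dim card by (intro card_le_dim_spanning[of _ UNIV]) auto
  ultimately show ?thesis
    using u by (simp add: indexed_basis_def)
qed

text \<open>The triangular relations express each \<open>u i\<close> through the initial basis vectors and, since the
  diagonal coordinates are nonzero, can be solved for these in turn.\<close>

lemma triangular_span:
  assumes e: "indexed_basis d e"
    and tri: "\<And>i k. i < k \<Longrightarrow> k \<le> d \<Longrightarrow> coord d e (u i) k = 0"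
    and diag: "\<And>i. i \<le> d \<Longrightarrow> coord d e (u i) i \<noteq> 0"
    and "i \<le> d"
  shows "span (u ` {..i}) = span (e ` {..i})"
  using \<open>i \<le> d\<close>
proof (induction i rule: less_induct)
  case (less i)
  define c where "c = coord d e (u i)"
  define r where "r = (\<Sum>k<i. c k *s e k)"
  have "u i = (\<Sum>k\<le>d. c k *s e k)"
    using e by (simp add: c_def coord_expand)
  also have "\<dots> = (\<Sum>k\<le>i. c k *s e k)"
    using less.prems tri by (intro sum.mono_neutral_right) (auto simp: c_def)
  finally have ui: "u i = r + c i *s e i"
    by (simp add: r_def lessThan_Suc_atMost[symmetric])
  have ci: "c i \<noteq> 0"
    using diag[OF less.prems] by (simp add: c_def)
  have IH: "span (u ` {..<i}) = span (e ` {..<i})"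
  proof (cases i)
    case (Suc m)
    with less show ?thesis
      by (simp add: lessThan_Suc_atMost)
  qed simp
  have r: "r \<in> span (e ` {..<i})"
    unfolding r_def by (intro span_sum span_scale span_base) auto
  have sets: "{..i} = insert i {..<i}"
    by auto
  have "e i = inverse (c i) *s (u i - r)"
    using ci by (simp add: ui)
  moreover have "u i \<in> span (insert (u i) (u ` {..<i}))" "r \<in> span (insert (u i) (u ` {..<i}))"
    using r span_mono[of "u ` {..<i}" "insert (u i) (u ` {..<i})"]
    by (auto simp: IH[symmetric] intro: span_base)
  ultimately have "e i \<in> span (insert (u i) (u ` {..<i}))"
    by (metis span_scale span_diff)
  moreover have "u i \<in> span (insert (e i) (e ` {..<i}))"
    unfolding ui using r span_mono[of "e ` {..<i}" "insert (e i) (e ` {..<i})"]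
    by (intro span_add span_scale) (auto intro: span_base)
  moreover have "e ` {..<i} \<subseteq> span (insert (u i) (u ` {..<i}))"
    using IH span_superset[of "e ` {..<i}"] span_mono[of "u ` {..<i}" "insert (u i) (u ` {..<i})"]
    by auto
  moreover have "u ` {..<i} \<subseteq> span (insert (e i) (e ` {..<i}))"
    using IH span_superset[of "u ` {..<i}"] span_mono[of "e ` {..<i}" "insert (e i) (e ` {..<i})"]
    by auto
  ultimately show ?case
    unfolding sets image_insert by (subst span_eq) (auto intro: span_base)
qed

lemma triangular_is_basis:
  assumes "indexed_basis d e"
    and "\<And>i k. i < k \<Longrightarrow> k \<le> d \<Longrightarrow> coord d e (u i) k = 0"
    and "\<And>i. i \<le> d \<Longrightarrow> coord d e (u i) i \<noteq> 0"
  shows "indexed_basis d u"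
proof (rule spanning_family_is_basis[OF assms(1)])
  have "span (u ` {..d}) = span (e ` {..d})"
    using assms by (rule triangular_span) auto
  then show "span (u ` {..d}) = UNIV"
    using assms(1) by (simp add: indexed_basis_def)
qed

lemma reversed_image: "(\<lambda>j. e (d - j)) ` {..d} = e ` {..d::nat}"
proof (intro equalityI subsetI)
  fix x assume "x \<in> e ` {..d}"
  then obtain j where "j \<le> d" "x = e (d - (d - j))"
    by auto
  then show "x \<in> (\<lambda>j. e (d - j)) ` {..d}"
    by (intro image_eqI[of _ _ "d - j"]) auto
qed auto

lemma coord_reverse: "coord d (\<lambda>j. e (d - j)) x i = coord d e x (d - i)"
  by (simp add: coord_def reversed_image)

lemma indexed_basis_reverse:
  assumes "indexed_basis d e"
  shows "indexed_basis d (\<lambda>j. e (d - j))"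
proof -
  have "inj_on (\<lambda>j. e (d - j)) {..d}"
  proof (rule inj_onI)
    fix i j assume "i \<in> {..d}" "j \<in> {..d}" "e (d - i) = e (d - j)"
    moreover from this have "d - i = d - j"
      using assms by (intro inj_onD[of e "{..d}"]) (auto simp: indexed_basis_def)
    ultimately show "i = j"
      by simp
  qed
  then show ?thesis
    using assms by (simp add: indexed_basis_def reversed_image)
qed

lemma irreducible_tridiagonal_reverse:
  assumes "irreducible_tridiagonal_upto d (matrix_wrt d e X)"
  shows "irreducible_tridiagonal_upto d (matrix_wrt d (\<lambda>j. e (d - j)) X)"
proof -
  let ?B = "matrix_wrt d e X"
  have rev: "matrix_wrt d (\<lambda>j. e (d - j)) X i j = ?B (d - i) (d - j)" for i j
    by (simp add: matrix_wrt_coord coord_reverse)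
  have "i = j \<or> i = Suc j \<or> j = Suc i" if "i \<le> d" "j \<le> d" "?B (d - i) (d - j) \<noteq> 0" for i j
  proof -
    have "d - i = d - j \<or> d - i = Suc (d - j) \<or> d - j = Suc (d - i)"
      using assms that(3) by (auto simp: irreducible_tridiagonal_upto_def tridiagonal_upto_def)
    then show ?thesis
      using that by linarith
  qed
  moreover have "?B (d - Suc i) (d - i) \<noteq> 0 \<and> ?B (d - i) (d - Suc i) \<noteq> 0" if "i < d" for i
  proof -
    have "d - Suc i < d" "Suc (d - Suc i) = d - i"
      using that by auto
    then show ?thesis
      using assms unfolding irreducible_tridiagonal_upto_def by metis
  qed
  ultimately show ?thesis
    by (simp add: irreducible_tridiagonal_upto_def tridiagonal_upto_def rev)
qed

section \<open>Polynomials in an endomorphism\<close>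

lemma poly_map_upto:
  assumes "degree p \<le> n"
  shows "poly_map p X x = (\<Sum>k\<le>n. coeff p k *s (X ^^ k) x)"
  unfolding poly_map_def using assms
  by (intro sum.mono_neutral_left) (auto simp: coeff_eq_0)

lemma poly_map_0: "poly_map 0 X x = 0"
  by (simp add: poly_map_def)

lemma poly_map_pCons:
  assumes "X \<in> End"
  shows "poly_map (pCons a p) X x = a *s x + X (poly_map p X x)"
proof -
  have "poly_map (pCons a p) X x = (\<Sum>k\<le>Suc (degree p). coeff (pCons a p) k *s (X ^^ k) x)"
    by (intro poly_map_upto) (simp add: degree_pCons_le)
  also have "\<dots> = a *s x + (\<Sum>k\<le>degree p. coeff p k *s X ((X ^^ k) x))"
    by (subst sum.atMost_Suc_shift) simp
  finally show ?thesis
    using assms by (simp add: poly_map_def End_sum End_scale)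
qed

lemma poly_map_add: "poly_map (p + q) X x = poly_map p X x + poly_map q X x"
proof -
  let ?n = "max (degree p) (degree q)"
  have "poly_map r X x = (\<Sum>k\<le>?n. coeff r k *s (X ^^ k) x)" if "degree r \<le> ?n" for r
    using that by (rule poly_map_upto)
  then show ?thesis
    by (simp add: degree_add_le scale_left_distrib sum.distrib)
qed

lemma poly_map_smult: "poly_map (smult c p) X x = c *s poly_map p X x"
  using poly_map_upto[of "smult c p" "degree p" X x]
  by (simp add: degree_smult_le poly_map_def scale_sum_right)

lemma poly_map_End:
  assumes "X \<in> End"
  shows "poly_map p X \<in> End"
proof -
  have "\<forall>x y. poly_map p X (x + y) = poly_map p X x + poly_map p X y"
    using assms by (induction p) (auto simp: poly_map_0 poly_map_pCons End_add scale_right_distrib)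
  moreover have "\<forall>c x. poly_map p X (c *s x) = c *s poly_map p X x"
    using assms
    by (induction p) (auto simp: poly_map_0 poly_map_pCons End_scale scale_right_distrib mult.commute)
  ultimately show ?thesis
    by (simp add: End_iff)
qed

lemma poly_map_mult:
  assumes "X \<in> End"
  shows "poly_map (p * q) X x = poly_map p X (poly_map q X x)"
  using assms
  by (induction p) (auto simp: poly_map_0 poly_map_pCons poly_map_add poly_map_smult)

lemma poly_map_intertwine:
  assumes "S \<in> End" "X \<in> End" "Y \<in> End" "\<And>x. S (X x) = Y (S x)"
  shows "S (poly_map p X x) = poly_map p Y (S x)"
  using assms by (induction p) (auto simp: poly_map_0 poly_map_pCons End_add End_scale End_zero)

lemma coord_eigenbasis:
  assumes e: "indexed_basis d e" and X: "X \<in> End"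
    and eig: "\<And>i. i \<le> d \<Longrightarrow> X (e i) = \<theta> i *s e i" and i: "i \<le> d"
  shows "coord d e (X x) i = \<theta> i * coord d e x i"
proof -
  have "X x = (\<Sum>j\<le>d. coord d e x j *s X (e j))"
    using X by (subst coord_expand[OF e, of x, symmetric]) (simp add: End_sum End_scale)
  also have "\<dots> = (\<Sum>j\<le>d. (\<theta> j * coord d e x j) *s e j)"
    using eig by (intro sum.cong) (auto simp: mult.commute)
  finally show ?thesis
    using e i by (simp add: coord_combination)
qed

lemma coord_poly_map_eigenbasis:
  assumes "indexed_basis d e" "X \<in> End"
    and "\<And>i. i \<le> d \<Longrightarrow> X (e i) = \<theta> i *s e i" and "i \<le> d"
  shows "coord d e (poly_map p X x) i = poly p (\<theta> i) * coord d e x i"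
proof (induction p)
  case (pCons a p)
  then show ?case
    using assms coord_eigenbasis[OF assms]
    by (simp add: poly_map_pCons coord_add coord_scale algebra_simps)
qed (simp add: poly_map_0 coord_zero)

section \<open>Irreducible tridiagonal action\<close>

abbreviation irreducible_on :: "nat \<Rightarrow> (nat \<Rightarrow> 'b) \<Rightarrow> ('b \<Rightarrow> 'b) \<Rightarrow> bool" where
  "irreducible_on d e X \<equiv> irreducible_tridiagonal_upto d (matrix_wrt d e X)"

lemma irreducible_on_entries:
  assumes "irreducible_on d e X"
  shows "\<lbrakk>i \<le> d; j \<le> d; Suc j < i \<or> Suc i < j\<rbrakk> \<Longrightarrow> matrix_wrt d e X i j = 0"
    and "i < d \<Longrightarrow> matrix_wrt d e X (Suc i) i \<noteq> 0"
    and "i < d \<Longrightarrow> matrix_wrt d e X i (Suc i) \<noteq> 0"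
proof -
  have "tridiagonal_upto d (matrix_wrt d e X)"
    using assms by (simp add: irreducible_tridiagonal_upto_def)
  then show "\<lbrakk>i \<le> d; j \<le> d; Suc j < i \<or> Suc i < j\<rbrakk> \<Longrightarrow> matrix_wrt d e X i j = 0"
    unfolding tridiagonal_upto_def by (metis less_Suc_eq less_irrefl not_less_eq Suc_lessD)
qed (use assms in \<open>auto simp: irreducible_tridiagonal_upto_def\<close>)

definition subdiagonal_product :: "nat \<Rightarrow> (nat \<Rightarrow> 'b) \<Rightarrow> ('b \<Rightarrow> 'b) \<Rightarrow> nat \<Rightarrow> 'a" where
  "subdiagonal_product d e X j = (\<Prod>i<j. matrix_wrt d e X (Suc i) i)"

lemma subdiagonal_product_nonzero:
  "irreducible_on d e X \<Longrightarrow> j \<le> d \<Longrightarrow> subdiagonal_product d e X j \<noteq> 0"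
  unfolding subdiagonal_product_def using irreducible_on_entries(2)[of d e X] by auto

text \<open>Each application of \<open>X\<close> moves the support of a vector by at most one step, and the weight
  of the only path of length \<open>j\<close> from \<open>0\<close> to \<open>j\<close> is the product of the subdiagonal entries.\<close>

lemma coord_power_first:
  assumes e: "indexed_basis d e" and X: "X \<in> End" and irr: "irreducible_on d e X"
  shows "j \<le> d \<Longrightarrow> k \<le> j \<Longrightarrow>
    coord d e ((X ^^ k) (e 0)) j = (if k = j then subdiagonal_product d e X j else 0)"
proof (induction k arbitrary: j)
  case 0
  then show ?case
    using e by (simp add: coord_basis subdiagonal_product_def)
next
  case (Suc k)
  let ?B = "matrix_wrt d e X" and ?y = "(X ^^ k) (e 0)"
  have "coord d e ((X ^^ Suc k) (e 0)) j = (\<Sum>l\<le>d. ?B j l * coord d e ?y l)"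
    using e X by (simp add: coord_End)
  also have "\<dots> = (\<Sum>l\<in>{k}. ?B j l * coord d e ?y l)"
  proof (intro sum.mono_neutral_right ballI)
    fix l assume l: "l \<in> {..d} - {k}"
    show "?B j l * coord d e ?y l = 0"
    proof (cases "l < k")
      case True
      then show ?thesis
        using irreducible_on_entries(1)[OF irr, of j l] Suc.prems l by simp
    next
      case False
      then show ?thesis
        using Suc.IH[of l] l by simp
    qed
  qed (use Suc.prems in auto)
  also have "\<dots> = ?B j k * subdiagonal_product d e X k"
    using Suc.IH[of k] Suc.prems by simp
  also have "\<dots> = (if Suc k = j then subdiagonal_product d e X j else 0)"
    using irreducible_on_entries(1)[OF irr, of j k] Suc.prems
    by (auto simp: subdiagonal_product_def)
  finally show ?case .
qed

lemma coord_poly_map_first: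
  assumes "indexed_basis d e" "X \<in> End" "irreducible_on d e X" "j \<le> d" "degree p \<le> j"
  shows "coord d e (poly_map p X (e 0)) j = coeff p j * subdiagonal_product d e X j"
proof -
  have "coord d e (poly_map p X (e 0)) j = (\<Sum>k\<le>j. coeff p k * coord d e ((X ^^ k) (e 0)) j)"
    using assms by (simp add: poly_map_upto coord_sum coord_scale)
  also have "\<dots> = (\<Sum>k\<le>j. if k = j then coeff p j * subdiagonal_product d e X j else 0)"
    using assms by (intro sum.cong) (auto simp: coord_power_first)
  finally show ?thesis
    by simp
qed

text \<open>The coordinates of an eigenvector satisfy a three-term recurrence with nonzero
  coefficients, so they all vanish once the initial one does.\<close>

lemma eigenvector_first_coord_nonzero:
  assumes e: "indexed_basis d e" and X: "X \<in> End" and irr: "irreducible_on d e X"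
    and eig: "X y = t *s y" and "y \<noteq> 0"
  shows "coord d e y 0 \<noteq> 0"
proof
  assume zero: "coord d e y 0 = 0"
  have "\<forall>j\<le>i. j \<le> d \<longrightarrow> coord d e y j = 0" for i
  proof (induction i)
    case 0
    then show ?case using zero by simp
  next
    case (Suc i)
    have "coord d e y (Suc i) = 0" if "Suc i \<le> d"
    proof -
      let ?B = "matrix_wrt d e X"
      have "t * coord d e y i = coord d e (X y) i"
        using e by (simp add: eig coord_scale)
      also have "\<dots> = (\<Sum>l\<le>d. ?B i l * coord d e y l)"
        using e X by (rule coord_End)
      also have "\<dots> = (\<Sum>l\<in>{Suc i}. ?B i l * coord d e y l)"
      proof (intro sum.mono_neutral_right ballI)
        fix l assume l: "l \<in> {..d} - {Suc i}"
        show "?B i l * coord d e y l = 0"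
        proof (cases "l \<le> i")
          case True
          then show ?thesis
            using Suc.IH l by simp
        next
          case False
          then show ?thesis
            using irreducible_on_entries(1)[OF irr, of i l] that l by simp
        qed
      qed (use that in auto)
      finally show ?thesis
        using Suc.IH that irreducible_on_entries(3)[OF irr, of i] by simp
    qed
    then show ?case
      using Suc.IH by (auto simp: le_Suc_eq)
  qed
  then have "y = 0"
    by (intro coord_eqI[OF e]) (auto simp: coord_zero)
  with \<open>y \<noteq> 0\<close> show False ..
qed

text \<open>An irreducible tridiagonal endomorphism has a cyclic vector, so no nonzero polynomial of
  degree at most \<open>d\<close> annihilates it; a repeated eigenvalue would yield such a polynomial.\<close>

lemma irreducible_multiplicity_free:
  assumes e: "indexed_basis d e" and X: "X \<in> End" and irr: "irreducible_on d e X"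
    and v: "indexed_basis m v" and eig: "\<And>i. i \<le> m \<Longrightarrow> X (v i) = t i *s v i"
  shows "inj_on t {..m}"
proof -
  have "m = d"
    using indexed_basis_dim[OF e] indexed_basis_dim[OF v] by simp
  define p where "p = (\<Prod>s\<in>t ` {..m}. [:- s, 1:])"
  have deg: "degree p = card (t ` {..m})" and lead: "lead_coeff p = 1"
    unfolding p_def
    by (rule degree_prod_monic_linear, simp, rule lead_coeff_prod_monic_linear)
  have "poly p (t i) = 0" if "i \<le> m" for i
    using that by (auto simp: p_def poly_prod)
  then have "poly_map p X x = 0" for x
    using coord_poly_map_eigenbasis[OF v X eig] by (intro coord_eqI[OF v]) (simp add: coord_zero)
  then have "coeff p (degree p) * subdiagonal_product d e X (degree p) = 0" if "degree p \<le> d"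
    using coord_poly_map_first[OF e X irr that order_refl] by (simp add: coord_zero)
  then have "d < degree p"
    using lead subdiagonal_product_nonzero[OF irr, of "degree p"] by fastforce
  then show ?thesis
    using deg \<open>m = d\<close> card_image_le[of "{..m}" t] by (intro eq_card_imp_inj_on) auto
qed

section \<open>The eigenbasis of a standard ordering\<close>

text \<open>An eigenvector for \<open>s\<close> has a nonzero coordinate, say at \<open>v j\<close>, which forces \<open>s = t j\<close>. As the
  eigenvalues are distinct, the conditions on \<open>Q\<close> then fix its value at every basis vector.\<close>

lemma primitive_idempotent_iff_coordinate_projection:
  assumes v: "indexed_basis m v" and X: "X \<in> End"
    and eig: "\<And>i. i \<le> m \<Longrightarrow> X (v i) = t i *s v i" and inj: "inj_on t {..m}"
  shows "primitive_idempotent_at X s Q \<longleftrightarrow> (\<exists>j\<le>m. s = t j \<and> Q = (\<lambda>x. coord m v x j *s v j))"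
proof
  assume Q: "primitive_idempotent_at X s Q"
  then obtain x where x: "X x = s *s x" "x \<noteq> 0"
    by (auto simp: primitive_idempotent_at_def eigenvalue_def eigenspace_def)
  then obtain j where j: "j \<le> m" "coord m v x j \<noteq> 0"
    using coord_eqI[OF v, of x 0] by (auto simp: coord_zero)
  have "t j * coord m v x j = s * coord m v x j"
    using coord_eigenbasis[OF v X eig j(1), of x] v by (simp only: x(1) coord_scale)
  then have s: "s = t j"
    using j(2) by (metis mult_right_cancel)
  have Q_basis: "Q (v i) = (if i = j then v j else 0)" if "i \<le> m" for i
  proof (cases "i = j")
    case False
    then have "t i \<noteq> s"
      using inj that j(1) by (auto simp: s inj_on_def)
    then show ?thesis
      using Q eig[OF that] False by (simp add: primitive_idempotent_at_def eigenspace_def)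
  qed (use Q eig[OF that] in \<open>simp add: primitive_idempotent_at_def eigenspace_def s\<close>)
  have "Q y = coord m v y j *s v j" for y
  proof -
    have "Q y = (\<Sum>i\<le>m. coord m v y i *s Q (v i))"
      using Q by (subst coord_expand[OF v, of y, symmetric])
        (simp add: primitive_idempotent_at_def End_sum End_scale)
    also have "\<dots> = (\<Sum>i\<le>m. if i = j then coord m v y j *s v j else 0)"
      by (intro sum.cong) (auto simp: Q_basis)
    finally show ?thesis
      using j by simp
  qed
  then show "\<exists>j\<le>m. s = t j \<and> Q = (\<lambda>x. coord m v x j *s v j)"
    using s j by auto
next
  assume "\<exists>j\<le>m. s = t j \<and> Q = (\<lambda>x. coord m v x j *s v j)"
  then obtain j where j: "j \<le> m" and s: "s = t j" and Q: "Q = (\<lambda>x. coord m v x j *s v j)"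
    by blast
  have vanish: "coord m v x i = 0" if "X x = r *s x" "i \<le> m" "r \<noteq> t i" for x r i
  proof -
    have "t i * coord m v x i = r * coord m v x i"
      using coord_eigenbasis[OF v X eig that(2), of x] v by (simp only: that(1) coord_scale)
    then show ?thesis
      using that(3) by simp
  qed
  have "coord m v x j *s v j = x" if x: "X x = t j *s x" for x
  proof (rule coord_eqI[OF v])
    fix i assume i: "i \<le> m"
    show "coord m v (coord m v x j *s v j) i = coord m v x i"
    proof (cases "i = j")
      case False
      then have "t j \<noteq> t i"
        using inj i j by (auto simp: inj_on_def)
      then show ?thesis
        using vanish[OF x i] v i j False by (simp add: coord_scale coord_basis)
    qed (use v j in \<open>simp add: coord_scale coord_basis\<close>)
  qed
  moreover have "Q \<in> End"
    unfolding Q using v by (simp add: End_iff coord_add coord_scale scale_left_distrib)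
  moreover have "eigenvalue X (t j)"
    using eig[OF j] indexed_basis_nonzero[OF v j] by (auto simp: eigenvalue_def eigenspace_def)
  ultimately show "primitive_idempotent_at X s Q"
    using vanish[OF _ j] by (auto simp: primitive_idempotent_at_def eigenspace_def s Q)
qed

lemma leonard_pair_swap: "leonard_pair A As \<Longrightarrow> leonard_pair As A"
  by (auto simp: leonard_pair_def)

definition ordered_eigenbasis ::
  "nat \<Rightarrow> ('b \<Rightarrow> 'b) \<Rightarrow> (nat \<Rightarrow> 'b \<Rightarrow> 'b) \<Rightarrow> (nat \<Rightarrow> 'b) \<Rightarrow> (nat \<Rightarrow> 'a) \<Rightarrow> bool" where
  "ordered_eigenbasis d A E e \<theta> \<longleftrightarrow>
     indexed_basis d e \<and> inj_on \<theta> {..d} \<and>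
     (\<forall>i\<le>d. A (e i) = \<theta> i *s e i \<and> E i = (\<lambda>x. coord d e x i *s e i))"

text \<open>A Leonard pair comes with an eigenbasis of \<open>A\<close>, but in an order unrelated to that of \<open>E\<close>.
  Since \<open>A\<close> has simple spectrum, the primitive idempotents are exactly the coordinate projections
  of this eigenbasis, so a suitable permutation of it matches \<open>E\<close>. Only then is it known that
  nonzero vectors of the \<open>range (E i)\<close> form a basis, so that the matrix in the definition of a
  standard ordering represents \<open>As\<close>.\<close>

lemma standard_ordering_eigenbasis:
  assumes pair: "leonard_pair A As" and std: "standard_ordering d A E As"
  obtains e where "ordered_eigenbasis d A E e (\<lambda>i. eigenvalue_of A (E i))"
    and "irreducible_on d e As"
proof -
  have A: "A \<in> End"
    using pair by (simp add: leonard_pair_def)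
  obtain n b where b: "indexed_basis n b" "irreducible_on n b A"
    using pair by (auto simp: leonard_pair_def)
  obtain m v where v: "indexed_basis m v" and diag: "diagonal_upto m (matrix_wrt m v A)"
    using pair by (auto simp: leonard_pair_def)
  define t where "t i = matrix_wrt m v A i i" for i
  have eig: "A (v j) = t j *s v j" if "j \<le> m" for j
  proof (rule coord_eqI[OF v])
    fix i assume "i \<le> m"
    then show "coord m v (A (v j)) i = coord m v (t j *s v j) i"
      using diag v that
      by (auto simp: coord_scale coord_basis t_def diagonal_upto_def matrix_wrt_coord)
  qed
  have inj: "inj_on t {..m}"
    using irreducible_multiplicity_free[OF b(1) A b(2) v] eig by blast
  define P where "P j = (\<lambda>x. coord m v x j *s v j)" for j
  have prim: "primitive_idempotent_at A s Q \<longleftrightarrow> (\<exists>j\<le>m. s = t j \<and> Q = P j)" for s Q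
    unfolding P_def by (rule primitive_idempotent_iff_coordinate_projection[OF v A eig inj])
  have inj_P: "inj_on P {..m}"
  proof (rule inj_onI)
    fix i j assume ij: "i \<in> {..m}" "j \<in> {..m}" "P i = P j"
    then have "P j (v i) = v i"
      using v by (simp add: ij(3)[symmetric]) (simp add: P_def coord_basis)
    then show "i = j"
      using v ij indexed_basis_nonzero[OF v, of i] by (auto simp: P_def coord_basis split: if_splits)
  qed
  have "primitive_idempotents A = P ` {..m}"
    by (auto simp: primitive_idempotents_def prim)
  then have E: "bij_betw E {..d} (P ` {..m})"
    using std by (simp add: standard_ordering_def)
  then have "card {..d} = card (P ` {..m})"
    by (rule bij_betw_same_card)
  then have "m = d"
    using inj_P by (simp add: card_image)
  define \<pi> where "\<pi> = inv_into {..d} P \<circ> E"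
  have bij: "bij_betw \<pi> {..d} {..d}"
    unfolding \<pi>_def using E inj_P \<open>m = d\<close>
    by (auto intro!: bij_betw_trans bij_betw_inv_into simp: inj_on_imp_bij_betw)
  have E_P: "E i = P (\<pi> i)" if "i \<le> d" for i
  proof -
    have "E i \<in> P ` {..d}"
      using E that \<open>m = d\<close> by (auto simp: bij_betw_def)
    then show ?thesis
      by (simp add: \<pi>_def f_inv_into_f)
  qed
  have \<pi>: "\<pi> i \<le> d" if "i \<le> d" for i
    using bij that by (auto simp: bij_betw_def)
  define e where "e = v \<circ> \<pi>"
  have image: "e ` {..d} = v ` {..d}"
    using bij by (metis e_def bij_betw_def image_comp)
  have "inj_on e {..d}"
    unfolding e_def using bij v \<open>m = d\<close>
    by (intro comp_inj_on) (auto simp: bij_betw_def indexed_basis_def)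
  then have e: "indexed_basis d e"
    using v \<open>m = d\<close> by (simp add: indexed_basis_def image)
  have coord_e: "coord d e x i = coord m v x (\<pi> i)" for x i
    by (simp add: coord_def image \<open>m = d\<close>) (simp add: e_def)
  have E_coord: "E i = (\<lambda>x. coord d e x i *s e i)" if "i \<le> d" for i
    using E_P[OF that] by (simp add: P_def coord_e) (simp add: e_def)
  have val: "eigenvalue_of A (E i) = t (\<pi> i)" if "i \<le> d" for i
    unfolding eigenvalue_of_def
  proof (rule the_equality)
    show "primitive_idempotent_at A (t (\<pi> i)) (E i)"
      using \<pi>[OF that] E_P[OF that] \<open>m = d\<close> by (auto simp: prim)
    show "s = t (\<pi> i)" if "primitive_idempotent_at A s (E i)" for s
      using that \<pi>[OF \<open>i \<le> d\<close>] E_P[OF \<open>i \<le> d\<close>] \<open>m = d\<close> inj_onD[OF inj_P] by (force simp: prim)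
  qed
  have "inj_on (t \<circ> \<pi>) {..d}"
    using bij inj \<open>m = d\<close> by (intro comp_inj_on) (auto simp: bij_betw_def)
  then have "inj_on (\<lambda>i. eigenvalue_of A (E i)) {..d}"
    by (rule inj_on_cong[THEN iffD1, rotated]) (simp add: val)
  moreover have "A (e i) = eigenvalue_of A (E i) *s e i" if "i \<le> d" for i
    using eig[of "\<pi> i"] \<pi>[OF that] \<open>m = d\<close> by (simp add: val[OF that] e_def)
  ultimately have "ordered_eigenbasis d A E e (\<lambda>i. eigenvalue_of A (E i))"
    using e E_coord by (simp add: ordered_eigenbasis_def)
  moreover have "e i \<in> range (E i)" if "i \<le> d" for i
    using e that by (auto intro!: image_eqI[of _ _ "e i"] simp: E_coord coord_basis)
  then have "irreducible_on d e As"
    using std indexed_basis_nonzero[OF e] by (simp add: standard_ordering_def)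
  ultimately show thesis
    using that by blast
qed

lemma ordered_eigenbasis_range:
  assumes "ordered_eigenbasis d A E e \<theta>" "i \<le> d"
  shows "range (E i) = span {e i}"
proof -
  have e: "indexed_basis d e" and E: "E i = (\<lambda>x. coord d e x i *s e i)"
    using assms by (auto simp: ordered_eigenbasis_def)
  have "E i (c *s e i) = c *s e i" for c
    using e assms(2) by (simp add: E coord_scale coord_basis)
  then have "c *s e i \<in> range (E i)" for c
    by (metis rangeI)
  then show ?thesis
    unfolding span_singleton by (auto simp: E)
qed

section \<open>Flags and decompositions adapted to a basis\<close>

text \<open>Two flags are opposite exactly if some basis spans one of them when read forwards and the
  other when read backwards; the basis vectors then span the components of the decomposition.\<close>

definition adapted_basis ::
  "nat \<Rightarrow> (nat \<Rightarrow> 'b) \<Rightarrow> (nat \<Rightarrow> 'b set) \<Rightarrow> (nat \<Rightarrow> 'b set) \<Rightarrow> bool" where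
  "adapted_basis d u H H' \<longleftrightarrow> indexed_basis d u \<and>
     (\<forall>i\<le>d. span (u ` {..i}) = H i \<and> span ((\<lambda>j. u (d - j)) ` {..i}) = H' i)"

lemma adapted_basis_reverse:
  assumes "adapted_basis d u H H'"
  shows "adapted_basis d (\<lambda>j. u (d - j)) H' H"
proof -
  have "(\<lambda>j. u (d - (d - j))) ` {..i} = u ` {..i}" if "i \<le> d" for i
    using that by (intro image_cong) auto
  then show ?thesis
    using assms by (simp add: adapted_basis_def indexed_basis_reverse)
qed

lemma coord_zero_outside_span:
  assumes u: "indexed_basis d u" and I: "I \<subseteq> {..d}" and k: "k \<le> d" "k \<notin> I"
    and x: "x \<in> span (u ` I)"
  shows "coord d u x k = 0"
proof -
  have "subspace {x. coord d u x k = 0}"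
    using u by (auto simp: subspace_def coord_zero coord_add coord_scale)
  moreover have "u ` I \<subseteq> {x. coord d u x k = 0}"
    using u I k by (auto simp: coord_basis)
  ultimately show ?thesis
    using span_minimal x by blast
qed

lemma adapted_basis_inter:
  assumes u: "adapted_basis d u H H'" and i: "i \<le> d"
  shows "H i \<inter> H' (d - i) = span {u i}"
proof
  have b: "indexed_basis d u" and H: "H i = span (u ` {..i})"
    using u i by (auto simp: adapted_basis_def)
  have "H' (d - i) = span ((\<lambda>j. u (d - j)) ` {..d - i})"
    using u by (auto simp: adapted_basis_def)
  also have "(\<lambda>j. u (d - j)) ` {..d - i} = u ` {i..d}"
  proof (intro equalityI subsetI)
    fix x assume "x \<in> u ` {i..d}"
    then obtain j where "i \<le> j" "j \<le> d" "x = u (d - (d - j))"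
      by auto
    then show "x \<in> (\<lambda>j. u (d - j)) ` {..d - i}"
      by (intro image_eqI[of _ _ "d - j"]) auto
  qed (use i in auto)
  finally have H': "H' (d - i) = span (u ` {i..d})" .
  show "span {u i} \<subseteq> H i \<inter> H' (d - i)"
    unfolding H H' using i by (auto intro!: span_mono)
  show "H i \<inter> H' (d - i) \<subseteq> span {u i}"
  proof
    fix x assume x: "x \<in> H i \<inter> H' (d - i)"
    have "coord d u x k = 0" if k: "k \<le> d" "k \<noteq> i" for k
    proof (cases "k < i")
      case True
      then show ?thesis
        using x b k by (intro coord_zero_outside_span[of d u "{i..d}"]) (auto simp: H')
    next
      case False
      then show ?thesis
        using x b k i by (intro coord_zero_outside_span[of d u "{..i}"]) (auto simp: H)
    qed
    then have "x = coord d u x i *s u i"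
      using b i by (intro coord_eqI[OF b]) (auto simp: coord_scale coord_basis)
    then show "x \<in> span {u i}"
      by (metis span_base span_scale singletonI)
  qed
qed

lemma induced_flag_span: "induced_flag (\<lambda>j. span {u j}) i = span (u ` {..i})"
proof (induction i)
  case 0
  then show ?case
    by (simp add: induced_flag_def)
next
  case (Suc i)
  have "induced_flag (\<lambda>j. span {u j}) (Suc i) = span (u ` {..i}) + span {u (Suc i)}"
    using Suc by (simp add: induced_flag_def)
  also have "\<dots> = span (u ` {..i} \<union> {u (Suc i)})"
    unfolding span_Un set_plus_def by auto
  finally show ?case
    by (simp add: atMost_Suc)
qed

lemma component_in_induced_flag:
  assumes "\<And>j. j \<le> i \<Longrightarrow> subspace (V j)"
  shows "V i \<subseteq> induced_flag V i"
proof
  fix x assume "x \<in> V i"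
  then show "x \<in> induced_flag V i"
    unfolding induced_flag_def using assms
    by (auto simp: set_sum_alt subspace_0 intro!: exI[of _ "\<lambda>j. if j = i then x else 0"])
qed

lemma adapted_basis_induces_flags:
  assumes u: "adapted_basis d u H H'"
  shows "induces_flags d (\<lambda>i. span {u i}) H H'"
proof -
  have b: "indexed_basis d u"
    using u by (simp add: adapted_basis_def)
  have "dim (span {u i}) = 1" if "i \<le> d" for i
    using indexed_basis_nonzero[OF b that] by (simp add: dim_eq_card_independent)
  moreover have "\<exists>!w. w \<in> (\<Pi>\<^sub>E i\<in>{..d}. span {u i}) \<and> (\<Sum>i\<le>d. w i) = x" for x
  proof
    let ?w = "restrict (\<lambda>i. coord d u x i *s u i) {..d}"
    show "?w \<in> (\<Pi>\<^sub>E i\<in>{..d}. span {u i}) \<and> (\<Sum>i\<le>d. ?w i) = x"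
      using coord_expand[OF b, of x] by (auto intro: span_scale span_base)
    fix w assume w: "w \<in> (\<Pi>\<^sub>E i\<in>{..d}. span {u i}) \<and> (\<Sum>i\<le>d. w i) = x"
    then have "\<forall>i\<in>{..d}. \<exists>a. w i = a *s u i"
      by (auto simp: span_singleton dest!: PiE_mem)
    then obtain a where a: "\<And>i. i \<le> d \<Longrightarrow> w i = a i *s u i"
      by (metis atMost_iff)
    then have "x = (\<Sum>i\<le>d. a i *s u i)"
      using w by (auto intro!: sum.cong)
    then have "a i = coord d u x i" if "i \<le> d" for i
      using coord_combination[OF b that, of a] by simp
    then show "w = ?w"
      using w a by (intro PiE_ext[of w "{..d}" "\<lambda>i. span {u i}"]) (auto intro: span_scale span_base)
  qed
  ultimately have "decomposition d (\<lambda>i. span {u i})"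
    by (simp add: decomposition_def)
  then show ?thesis
    using u by (simp add: induces_flags_def induced_flag_span adapted_basis_def)
qed

text \<open>Component \<open>i\<close> of any decomposition that induces the two flags lies in both \<open>H i\<close> and
  \<open>H' (d - i)\<close>. These meet in a line, so the component is that line and the choice made in
  \<open>induced_decomposition\<close> does not matter.\<close>

lemma induced_decomposition_inter:
  assumes u: "adapted_basis d u H H'" and i: "i \<le> d"
  shows "induced_decomposition d H H' i = H i \<inter> H' (d - i)"
proof -
  define V where "V = induced_decomposition d H H'"
  have "induces_flags d V H H'"
    unfolding V_def induced_decomposition_def
    using adapted_basis_induces_flags[OF u] by (rule someI[of "\<lambda>V. induces_flags d V H H'"])
  then have sub: "\<And>j. j \<le> d \<Longrightarrow> subspace (V j)" and dim: "dim (V i) = 1"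
    and H: "induced_flag V i = H i" and H': "induced_flag (\<lambda>j. V (d - j)) (d - i) = H' (d - i)"
    using i by (auto simp: induces_flags_def decomposition_def)
  have "V i \<subseteq> H i"
    using component_in_induced_flag[of i V] sub i by (simp add: H)
  moreover have "V i \<subseteq> H' (d - i)"
    using component_in_induced_flag[of "d - i" "\<lambda>j. V (d - j)"] sub i by (simp add: H')
  ultimately have V_sub: "V i \<subseteq> span {u i}"
    using adapted_basis_inter[OF u i] by blast
  have "V i \<noteq> {0}"
    using dim dim_eq_card[of "{}" "{0}"] by (auto simp: independent_empty)
  then obtain x where x: "x \<in> V i" "x \<noteq> 0"
    using subspace_0[OF sub[OF i]] by blast
  then obtain c where c: "x = c *s u i" "c \<noteq> 0"
    using V_sub by (auto simp: span_singleton)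
  then have "u i = inverse c *s x"
    by simp
  then have "u i \<in> V i"
    using subspace_scale[OF sub[OF i] x(1)] by simp
  then have "span {u i} \<subseteq> V i"
    using sub[OF i] by (intro span_minimal) auto
  then show ?thesis
    using V_sub adapted_basis_inter[OF u i] by (simp add: V_def)
qed

section \<open>The intertwiner of a duality\<close>

text \<open>An automorphism of the endomorphism algebra is conjugation by an invertible map. Here it can
  be written down: the rank one operators \<open>R x\<close> that send \<open>e 0\<close> to \<open>x\<close> and kill the other basis
  vectors satisfy \<open>Y \<circ> R x = R (Y x)\<close>, so \<open>x \<mapsto> \<sigma> (R x) (f 0)\<close> carries the
  action of \<open>Y\<close> to that of \<open>\<sigma> Y\<close>.\<close>

lemma automorphism_intertwiner:
  assumes \<sigma>: "End_automorphism \<sigma>" and e: "indexed_basis d e" and f: "indexed_basis d f"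
    and \<sigma>_0: "\<sigma> (\<lambda>x. coord d e x 0 *s e 0) = (\<lambda>x. coord d f x 0 *s f 0)"
  obtains S where "S \<in> End" "bij S" "S (e 0) = f 0"
    "\<And>Y x. Y \<in> End \<Longrightarrow> S (Y x) = \<sigma> Y (S x)"
proof -
  define R where "R x = (\<lambda>y. coord d e y 0 *s x)" for x
  have R: "R x \<in> End" for x
    using e by (simp add: R_def End_iff coord_add coord_scale scale_left_distrib)
  define S where "S x = \<sigma> (R x) (f 0)" for x
  have "S (x + y) = S x + S y" for x y
  proof -
    have "R (x + y) = (\<lambda>z. R x z + R y z)"
      by (simp add: R_def scale_right_distrib)
    then show ?thesis
      using \<sigma> R by (simp add: S_def End_automorphism_def)
  qed
  moreover have "S (c *s x) = c *s S x" for c x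
  proof -
    have "R (c *s x) = (\<lambda>z. c *s R x z)"
      by (simp add: R_def mult.commute)
    then show ?thesis
      using \<sigma> R by (simp add: S_def End_automorphism_def)
  qed
  ultimately have S: "S \<in> End"
    by (simp add: End_iff)
  have S_e0: "S (e 0) = f 0"
    using f by (simp add: S_def R_def \<sigma>_0 coord_basis)
  have inter: "S (Y x) = \<sigma> Y (S x)" if "Y \<in> End" for Y x
  proof -
    have "R (Y x) = Y \<circ> R x"
      using that by (auto simp: R_def End_scale)
    then show ?thesis
      using \<sigma> R that by (simp add: S_def End_automorphism_def)
  qed
  have kernel: "x = 0" if "S x = 0" for x
  proof (rule ccontr)
    assume "x \<noteq> 0"
    then obtain i where i: "coord d e x i \<noteq> 0"
      using coord_eqI[OF e, of x 0] by (auto simp: coord_zero)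
    \<comment> \<open>The kernel is stable under all endomorphisms, and some endomorphism maps \<open>x\<close> to \<open>e 0\<close>.\<close>
    define Y where "Y y = (coord d e y i / coord d e x i) *s e 0" for y
    have Y: "Y \<in> End"
      using e by (simp add: Y_def End_iff coord_add coord_scale add_divide_distrib scale_left_distrib)
    then have "\<sigma> Y \<in> End"
      using \<sigma> by (auto simp: End_automorphism_def bij_betw_def)
    then have "S (Y x) = 0"
      using inter[OF Y, of x] that by (simp add: End_zero)
    moreover have "Y x = e 0"
      using i by (simp add: Y_def)
    ultimately show False
      using S_e0 indexed_basis_nonzero[OF f, of 0] by simp
  qed
  interpret finite_dimensional_vector_space scale "e ` {..d}"
    using e by (rule indexed_basis_finite_dimensional)
  have lin: "Vector_Spaces.linear scale scale S"
    using S by (simp add: End_def)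
  then have "inj S"
    using S by (intro injI) (metis End_add diff_add_cancel add_cancel_right_left eq_iff_diff_eq_0 kernel)
  then have "bij S"
    using linear_inj_imp_surj[OF lin] by (simp add: bij_def)
  then show thesis
    using that S S_e0 inter by blast
qed

end

section \<open>Split bases\<close>

lemma degree_tau_poly: "degree (tau_poly (\<theta> :: nat \<Rightarrow> 'a::field) i) = i"
  unfolding tau_poly_def by (simp add: degree_prod_monic_linear)

lemma lead_coeff_tau_poly: "lead_coeff (tau_poly (\<theta> :: nat \<Rightarrow> 'a::field) i) = 1"
  unfolding tau_poly_def by (rule lead_coeff_prod_monic_linear)

lemma degree_eta_poly: "degree (eta_poly d (\<theta> :: nat \<Rightarrow> 'a::field) i) = i"
  unfolding eta_poly_def by (simp add: degree_prod_monic_linear)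

lemma lead_coeff_eta_poly: "lead_coeff (eta_poly d (\<theta> :: nat \<Rightarrow> 'a::field) i) = 1"
  unfolding eta_poly_def by (rule lead_coeff_prod_monic_linear)

lemma poly_tau_poly: "poly (tau_poly (\<theta> :: nat \<Rightarrow> 'a::field) i) x = (\<Prod>k<i. x - \<theta> k)"
  by (simp add: tau_poly_def poly_prod)

lemma poly_eta_poly: "poly (eta_poly d (\<theta> :: nat \<Rightarrow> 'a::field) i) x = (\<Prod>k<i. x - \<theta> (d - k))"
  by (simp add: eta_poly_def poly_prod)

text \<open>The data of a Leonard system in terms of ordered eigenbases \<open>e\<close> of \<open>A\<close> and \<open>f\<close> of \<open>As\<close>:
  reversing either basis, or exchanging the two endomorphisms, gives data of the same kind.\<close>

locale leonard_bases = linear_algebra_space scale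
  for scale :: "'a::field \<Rightarrow> 'b::ab_group_add \<Rightarrow> 'b" (infixr \<open>*s\<close> 75) +
  fixes d :: nat and A As :: "'b \<Rightarrow> 'b" and e f :: "nat \<Rightarrow> 'b" and \<theta> \<theta>s :: "nat \<Rightarrow> 'a"
  assumes A: "A \<in> End" and As: "As \<in> End"
    and e: "indexed_basis d e" and f: "indexed_basis d f"
    and A_e: "\<And>i. i \<le> d \<Longrightarrow> A (e i) = \<theta> i *s e i"
    and As_f: "\<And>i. i \<le> d \<Longrightarrow> As (f i) = \<theta>s i *s f i"
    and inj_\<theta>: "inj_on \<theta> {..d}" and inj_\<theta>s: "inj_on \<theta>s {..d}"
    and irr_e: "irreducible_on d e As" and irr_f: "irreducible_on d f A"
begin

lemma swap: "leonard_bases scale d As A f e \<theta>s \<theta>"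
  using A As e f A_e As_f inj_\<theta> inj_\<theta>s irr_e irr_f by unfold_locales

lemma reverse: "leonard_bases scale d A As (\<lambda>j. e (d - j)) f (\<lambda>j. \<theta> (d - j)) \<theta>s"
proof unfold_locales
  show "inj_on (\<lambda>j. \<theta> (d - j)) {..d}"
  proof (rule inj_onI)
    fix i j assume "i \<in> {..d}" "j \<in> {..d}" "\<theta> (d - i) = \<theta> (d - j)"
    moreover from this have "d - i = d - j"
      by (intro inj_onD[OF inj_\<theta>]) auto
    ultimately show "i = j"
      by simp
  qed
qed (use A As e f A_e As_f inj_\<theta>s irr_e irr_f in
     \<open>auto intro: indexed_basis_reverse irreducible_tridiagonal_reverse\<close>)

text \<open>The split vectors span the components of the decomposition \<open>[0\<^sup>*D]\<close>: multiplying by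
  \<open>\<tau>\<^sub>i(A)\<close> removes from \<open>f 0\<close> its components along \<open>e 0\<close>, \<dots>, \<open>e (i - 1)\<close> and moves its support
  in the basis \<open>f\<close> up to index \<open>i\<close>.\<close>

definition split_vector :: "nat \<Rightarrow> 'b" where
  "split_vector i = poly_map (tau_poly \<theta> i) A (f 0)"

lemma split_vector_coord_f:
  shows "i < k \<Longrightarrow> k \<le> d \<Longrightarrow> coord d f (split_vector i) k = 0"
    and "i \<le> d \<Longrightarrow> coord d f (split_vector i) i \<noteq> 0"
  using coord_poly_map_first[OF f A irr_f, of k "tau_poly \<theta> i"]
    coord_poly_map_first[OF f A irr_f, of i "tau_poly \<theta> i"]
    lead_coeff_tau_poly[of \<theta> i] subdiagonal_product_nonzero[OF irr_f, of i]
  by (auto simp: split_vector_def degree_tau_poly coeff_eq_0)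

lemma split_vector_coord_e:
  "i \<le> d \<Longrightarrow> coord d e (split_vector k) i = (\<Prod>j<k. \<theta> i - \<theta> j) * coord d e (f 0) i"
  unfolding split_vector_def
  using coord_poly_map_eigenbasis[OF e A A_e] by (simp add: poly_tau_poly)

lemma split_vector_basis: "indexed_basis d split_vector"
  using f split_vector_coord_f by (rule triangular_is_basis)

text \<open>The split vectors span the space and all lie in the orbit of \<open>f 0\<close> under \<open>A\<close>, so no
  \<open>A\<close>-invariant coordinate hyperplane contains \<open>f 0\<close>.\<close>

lemma coord_f0_nonzero:
  assumes "i \<le> d"
  shows "coord d e (f 0) i \<noteq> 0"
proof
  assume "coord d e (f 0) i = 0"
  then have "coord d e (split_vector k) i = 0" for k
    using assms by (simp add: split_vector_coord_e)
  then have "coord d e (\<Sum>k\<le>d. coord d split_vector (e i) k *s split_vector k) i = 0"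
    using e by (simp add: coord_sum coord_scale)
  then show False
    using coord_expand[OF split_vector_basis, of "e i"] e assms by (simp add: coord_basis)
qed

text \<open>The split vectors are triangular with respect to \<open>f\<close> and, in the opposite direction, with
  respect to \<open>e\<close>; hence the flag of \<open>f\<close> and the flag of the reversed basis \<open>e\<close> are opposite.\<close>

lemma split_vector_adapted:
  "adapted_basis d split_vector (\<lambda>i. span (f ` {..i})) (\<lambda>i. span ((\<lambda>j. e (d - j)) ` {..i}))"
  unfolding adapted_basis_def
proof (intro conjI allI impI)
  fix i assume i: "i \<le> d"
  show "span (split_vector ` {..i}) = span (f ` {..i})"
    using f split_vector_coord_f i by (rule triangular_span)
  show "span ((\<lambda>j. split_vector (d - j)) ` {..i}) = span ((\<lambda>j. e (d - j)) ` {..i})"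
  proof (rule triangular_span[OF indexed_basis_reverse[OF e] _ _ i])
    fix i k :: nat assume "i < k" "k \<le> d"
    then have "\<exists>j\<in>{..<d - i}. \<theta> (d - k) - \<theta> j = 0"
      by (intro bexI[of _ "d - k"]) auto
    then show "coord d (\<lambda>j. e (d - j)) (split_vector (d - i)) k = 0"
      by (simp add: coord_reverse split_vector_coord_e)
  next
    fix i assume "i \<le> d"
    have "\<theta> (d - i) - \<theta> j \<noteq> 0" if "j < d - i" for j
      using that inj_onD[OF inj_\<theta>, of "d - i" j] by force
    then show "coord d (\<lambda>j. e (d - j)) (split_vector (d - i)) i \<noteq> 0"
      by (simp add: coord_reverse split_vector_coord_e coord_f0_nonzero)
  qed
qed (rule split_vector_basis)

end

section \<open>The duality map\<close>

context leonard_bases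
begin

text \<open>The map \<open>Es 0 \<circ> E d\<close> extracts the \<open>e d\<close>-coordinate and multiplies \<open>f 0\<close> by a fixed multiple of
  it, nonzero because the eigenvector \<open>e d\<close> of \<open>A\<close> has a nonzero initial coordinate.
  Evaluate on the basis \<open>\<eta>\<^sub>d\<^sub>-\<^sub>j(As) (e 0)\<close>. The term of index \<open>i\<close> sees only the \<open>e d\<close>-coordinate
  of \<open>\<tau>\<^sub>i(As) \<eta>\<^sub>d\<^sub>-\<^sub>j(As) (e 0)\<close>. For \<open>i < j\<close> the polynomial has degree less than \<open>d\<close>, too small
  to reach \<open>e d\<close>; for \<open>i > j\<close> it vanishes at every eigenvalue of \<open>As\<close>,
  since \<open>\<theta> = \<theta>s\<close>; for \<open>i = j\<close> it is monic of
  degree \<open>d\<close>, so the coordinate is the product of the subdiagonal entries whatever \<open>j\<close> is. This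
  leaves a multiple, independent of \<open>j\<close>, of \<open>\<eta>\<^sub>d\<^sub>-\<^sub>j(A) (f 0)\<close>, the image of the basis vector
  under \<open>S\<close>.\<close>

lemma duality_map_multiple_of_intertwiner:
  assumes E: "ordered_eigenbasis d A E e (\<lambda>i. eigenvalue_of A (E i))"
    and Es: "ordered_eigenbasis d As Es f (\<lambda>i. eigenvalue_of As (Es i))"
    and \<theta>_eq: "\<theta> = (\<lambda>i. eigenvalue_of A (E i))" and \<theta>s_eq: "\<theta>s = (\<lambda>i. eigenvalue_of As (Es i))"
    and dual: "\<And>i. i \<le> d \<Longrightarrow> \<theta> i = \<theta>s i"
    and S: "S \<in> End" "\<And>x. S (As x) = A (S x)" "S (e 0) = f 0"
  obtains c where "c \<noteq> 0" "\<And>x. duality_map d A E As Es x = c *s S x"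
proof -
  let ?T = "duality_map d A E As Es"
  define \<gamma> where "\<gamma> = coord d f (e d) 0"
  define \<delta> where "\<delta> = subdiagonal_product d e As d"
  have T: "?T x = (\<Sum>i\<le>d. (\<gamma> * coord d e (poly_map (tau_poly \<theta>s i) As x) d) *s
      poly_map (eta_poly d \<theta> (d - i)) A (f 0))" for x
  proof -
    have "Es 0 (E d y) = (\<gamma> * coord d e y d) *s f 0" for y
      using E Es f by (simp add: ordered_eigenbasis_def \<gamma>_def coord_scale mult.commute)
    then show ?thesis
      unfolding duality_map_def \<theta>_eq \<theta>s_eq using poly_map_End[OF A]
      by (simp add: End_scale)
  qed
  have T_End: "?T \<in> End"
    using poly_map_End[OF As] e
    by (simp add: End_iff T coord_add coord_scale distrib_left scale_left_distrib sum.distrib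
        scale_sum_right mult.left_commute)
  define w where "w j = poly_map (eta_poly d \<theta> (d - j)) As (e 0)" for j
  have coord_w: "coord d e (poly_map (tau_poly \<theta>s i) As (w j)) d = (if i = j then \<delta> else 0)"
    if "i \<le> d" "j \<le> d" for i j
  proof -
    let ?p = "tau_poly \<theta>s i * eta_poly d \<theta> (d - j)"
    have w: "poly_map (tau_poly \<theta>s i) As (w j) = poly_map ?p As (e 0)"
      using As by (simp add: w_def poly_map_mult)
    have "tau_poly \<theta>s i \<noteq> 0" "eta_poly d \<theta> (d - j) \<noteq> 0"
      by (metis lead_coeff_tau_poly leading_coeff_0_iff zero_neq_one)
         (metis lead_coeff_eta_poly leading_coeff_0_iff zero_neq_one)
    then have deg: "degree ?p = i + (d - j)"
      by (simp add: degree_mult_eq degree_tau_poly degree_eta_poly)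
    have lead: "lead_coeff ?p = 1"
      by (simp only: lead_coeff_mult lead_coeff_tau_poly lead_coeff_eta_poly mult_1)
    consider "i < j" | "i = j" | "j < i"
      by linarith
    then show ?thesis
    proof cases
      case 1
      then have "degree ?p < d"
        using that by (simp add: deg)
      then show ?thesis
        using 1 coord_poly_map_first[OF e As irr_e order_refl, of ?p] by (simp add: w coeff_eq_0)
    next
      case 2
      then have "degree ?p = d"
        using that deg by linarith
      then show ?thesis
        unfolding w using 2 lead coord_poly_map_first[OF e As irr_e order_refl, of ?p]
        by (simp add: \<delta>_def)
    next
      case 3
      have "poly ?p (\<theta>s k) = 0" if "k \<le> d" for k
      proof (cases "k < i")
        case True
        then show ?thesis
          by (auto simp: poly_tau_poly)
      next
        case False
        then have "d - k < d - j" "d - (d - k) = k"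
          using 3 that by auto
        then have "\<exists>l\<in>{..<d - j}. \<theta>s k - \<theta> (d - l) = 0"
          using dual[OF that] by (intro bexI[of _ "d - k"]) auto
        then show ?thesis
          by (simp add: poly_eta_poly)
      qed
      then have "poly_map ?p As (e 0) = 0"
        using coord_poly_map_eigenbasis[OF f As As_f]
        by (intro coord_eqI[OF f]) (simp add: coord_zero)
      then show ?thesis
        using 3 by (simp add: w coord_zero)
    qed
  qed
  have T_w: "?T (w j) = (\<gamma> * \<delta>) *s S (w j)" if "j \<le> d" for j
  proof -
    have "?T (w j) = (\<Sum>i\<le>d. if i = j
        then (\<gamma> * \<delta>) *s poly_map (eta_poly d \<theta> (d - j)) A (f 0) else 0)"
      unfolding T using that by (intro sum.cong) (auto simp: coord_w)
    also have "poly_map (eta_poly d \<theta> (d - j)) A (f 0) = S (w j)"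
      unfolding w_def using poly_map_intertwine[OF S(1) As A S(2)] S(3) by simp
    finally show ?thesis
      using that by simp
  qed
  have w_first: "coord d e (w (d - i)) k =
      coeff (eta_poly d \<theta> i) k * subdiagonal_product d e As k" if "i \<le> k" "k \<le> d" for i k
    using that coord_poly_map_first[OF e As irr_e, of k "eta_poly d \<theta> i"]
    by (simp add: w_def degree_eta_poly)
  have w_basis: "indexed_basis d (\<lambda>i. w (d - i))"
  proof (rule triangular_is_basis[OF e])
    fix i k assume "i < k" "k \<le> d"
    then show "coord d e (w (d - i)) k = 0"
      by (simp add: w_first degree_eta_poly coeff_eq_0)
  next
    fix i assume "i \<le> d"
    then show "coord d e (w (d - i)) i \<noteq> 0"
      using lead_coeff_eta_poly[of d \<theta> i] subdiagonal_product_nonzero[OF irr_e]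
      by (simp add: w_first degree_eta_poly)
  qed
  have "?T x = (\<gamma> * \<delta>) *s S x" for x
  proof -
    let ?c = "coord d (\<lambda>i. w (d - i)) x"
    have x: "x = (\<Sum>i\<le>d. ?c i *s w (d - i))"
      using coord_expand[OF w_basis, of x] by simp
    have "?T x = (\<Sum>i\<le>d. ?c i *s ?T (w (d - i)))"
      by (subst x) (simp add: End_sum[OF T_End] End_scale[OF T_End])
    also have "\<dots> = (\<gamma> * \<delta>) *s (\<Sum>i\<le>d. ?c i *s S (w (d - i)))"
      by (simp add: T_w scale_sum_right mult.commute mult.left_commute)
    also have "(\<Sum>i\<le>d. ?c i *s S (w (d - i))) = S x"
      by (subst (2) x) (simp add: End_sum[OF S(1)] End_scale[OF S(1)])
    finally show ?thesis .
  qed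
  moreover have "\<gamma> \<noteq> 0"
    unfolding \<gamma>_def
    using f A irr_f A_e[OF order_refl] indexed_basis_nonzero[OF e order_refl]
    by (rule eigenvector_first_coord_nonzero)
  moreover have "\<delta> \<noteq> 0"
    unfolding \<delta>_def using irr_e by (simp add: subdiagonal_product_nonzero)
  ultimately show thesis
    by (intro that[of "\<gamma> * \<delta>"]) auto
qed

end

section \<open>Action on flags and decompositions\<close>

context linear_algebra_space
begin

lemma image_induced_flag:
  assumes "X \<in> End"
  shows "X ` induced_flag V i = induced_flag (\<lambda>j. X ` V j) i"
proof -
  have plus: "X ` (P + Q) = X ` P + X ` Q" for P Q
    unfolding set_plus_image image_image using assms
    by (auto simp: End_add image_iff intro!: bexI)
  show ?thesis
    by (induction i) (auto simp: induced_flag_def plus)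
qed

lemma induced_flag_cong: "(\<And>j. j \<le> i \<Longrightarrow> V j = W j) \<Longrightarrow> induced_flag V i = induced_flag W i"
  unfolding induced_flag_def by (intro sum.cong) auto

end

context leonard_bases
begin

text \<open>The four flags come from \<open>e\<close>, \<open>f\<close> and their reversals. A pair taken from the same basis
  is opposite by construction; every other pair is obtained from the split vectors by reversing
  bases, possibly after exchanging the two flags.\<close>

lemma flags_mutually_opposite:
  assumes E: "\<And>i. i \<le> d \<Longrightarrow> range (E i) = span {e i}"
    and Es: "\<And>i. i \<le> d \<Longrightarrow> range (Es i) = span {f i}"
    and "z \<noteq> w"
  shows "\<exists>u. adapted_basis d u (flag_of d E Es z) (flag_of d E Es w)"
proof -
  have L0: "flag_of d E Es L0 i = span (e ` {..i})"
    and LD: "flag_of d E Es LD i = span ((\<lambda>j. e (d - j)) ` {..i})"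
    and L0s: "flag_of d E Es L0s i = span (f ` {..i})"
    and LDs: "flag_of d E Es LDs i = span ((\<lambda>j. f (d - j)) ` {..i})" if "i \<le> d" for i
    unfolding flag_of.simps induced_flag_span[symmetric]
    by (intro induced_flag_cong, use that in \<open>simp add: E Es\<close>)+
  have double: "(\<lambda>j. g (d - (d - j))) ` {..i} = g ` {..i}" if "i \<le> d" for i and g :: "nat \<Rightarrow> 'b"
    using that by (intro image_cong) auto
  \<comment> \<open>A twice reversed basis enters wherever the reversal of \<open>e\<close> takes the place of \<open>e\<close>.\<close>
  note flags = adapted_basis_def L0 LD L0s LDs double
  interpret rev_e: leonard_bases scale d A As "\<lambda>j. e (d - j)" f "\<lambda>j. \<theta> (d - j)" \<theta>s
    by (rule reverse)
  interpret rev_f: leonard_bases scale d A As e "\<lambda>j. f (d - j)" \<theta> "\<lambda>j. \<theta>s (d - j)"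
    by (rule leonard_bases.swap[OF leonard_bases.reverse[OF swap]])
  interpret rev_ef: leonard_bases scale d A As "\<lambda>j. e (d - j)" "\<lambda>j. f (d - j)"
      "\<lambda>j. \<theta> (d - j)" "\<lambda>j. \<theta>s (d - j)"
    by (rule rev_f.reverse)
  let ?opp = "\<lambda>z w. \<exists>u. adapted_basis d u (flag_of d E Es z) (flag_of d E Es w)"
  have sym: "?opp w z" if "?opp z w" for z w
    using that adapted_basis_reverse by blast
  have "?opp L0s LD"
    using split_vector_adapted by (intro exI[of _ split_vector]) (simp add: flags del: flag_of.simps)
  moreover have "?opp L0s L0"
    using rev_e.split_vector_adapted by (intro exI[of _ rev_e.split_vector]) (simp add: flags del: flag_of.simps)
  moreover have "?opp LDs LD"
    using rev_f.split_vector_adapted by (intro exI[of _ rev_f.split_vector]) (simp add: flags del: flag_of.simps)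
  moreover have "?opp LDs L0"
    using rev_ef.split_vector_adapted by (intro exI[of _ rev_ef.split_vector]) (simp add: flags del: flag_of.simps)
  moreover have "?opp L0 LD"
    using e by (intro exI[of _ e]) (simp add: flags del: flag_of.simps)
  moreover have "?opp L0s LDs"
    using f by (intro exI[of _ f]) (simp add: flags del: flag_of.simps)
  ultimately show ?thesis
    using sym \<open>z \<noteq> w\<close> by (cases z; cases w) blast+
qed

end

theorem proposition12p3:
  fixes scale :: "'a::field \<Rightarrow> 'b::ab_group_add \<Rightarrow> 'b"
    and Basis :: "'b set"
    and d :: nat
    and A As T :: "'b \<Rightarrow> 'b"
    and E Es :: "nat \<Rightarrow> 'b \<Rightarrow> 'b"
    and dec :: "flag_label \<Rightarrow> flag_label \<Rightarrow> nat \<Rightarrow> 'b set"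
  assumes "finite_dimensional_vector_space scale Basis"
    and "finite_dimensional_vector_space.dimension Basis > 0"
    and "linear_algebra_space.leonard_system scale d A E As Es"
    and "linear_algebra_space.self_dual scale d A E As Es"
    and "T = linear_algebra_space.duality_map scale d A E As Es"
    and "dec = linear_algebra_space.decomp scale d E Es"
  shows "(\<forall>i\<le>d. T ` dec L0s LD i = dec L0 LDs i) \<and>
         (\<forall>i\<le>d. T ` dec LDs LD i = dec LD LDs i) \<and>
         (\<forall>i\<le>d. T ` dec L0s L0 i = dec L0 L0s i) \<and>
         (\<forall>i\<le>d. T ` dec LDs L0 i = dec LD L0s i) \<and>
         (\<forall>i\<le>d. T ` dec L0 LD i = dec L0s LDs i) \<and>
         (\<forall>i\<le>d. T ` dec L0s LDs i = dec L0 LD i)"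
proof -
  interpret V: finite_dimensional_vector_space scale Basis
    by (rule assms(1))
  interpret linear_algebra_space scale
    by unfold_locales
  have sys: "leonard_pair A As" "standard_ordering d A E As" "standard_ordering d As Es A"
    using assms(3) by (auto simp: leonard_system_def)
  define \<theta> where "\<theta> = (\<lambda>i. eigenvalue_of A (E i))"
  define \<theta>s where "\<theta>s = (\<lambda>i. eigenvalue_of As (Es i))"
  obtain e where E: "ordered_eigenbasis d A E e \<theta>" and irr_e: "irreducible_on d e As"
    using standard_ordering_eigenbasis[OF sys(1,2)] unfolding \<theta>_def .
  obtain f where Es: "ordered_eigenbasis d As Es f \<theta>s" and irr_f: "irreducible_on d f A"
    using standard_ordering_eigenbasis[OF leonard_pair_swap[OF sys(1)] sys(3)] unfolding \<theta>s_def .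
  interpret leonard_bases scale d A As e f \<theta> \<theta>s
    using E Es irr_e irr_f sys(1)
    by unfold_locales (auto simp: ordered_eigenbasis_def leonard_pair_def)
  have E_End: "E i \<in> End" and Es_End: "Es i \<in> End" if "i \<le> d" for i
    using E Es e f that
    by (auto simp: ordered_eigenbasis_def End_iff coord_add coord_scale V.scale_left_distrib)
  obtain \<sigma> where \<sigma>: "End_automorphism \<sigma>" "\<sigma> A = As" "\<sigma> As = A"
    "\<And>i. i \<le> d \<Longrightarrow> \<sigma> (E i) = Es i" "\<And>i. i \<le> d \<Longrightarrow> \<sigma> (Es i) = E i"
    using assms(4) unfolding self_dual_def by blast
  have "\<sigma> (\<lambda>x. scale (coord d e x 0) (e 0)) = (\<lambda>x. scale (coord d f x 0) (f 0))"
    using E Es \<sigma>(4)[of 0] by (simp add: ordered_eigenbasis_def)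
  then obtain S where S: "S \<in> End" "bij S" "S (e 0) = f 0"
    and S_inter: "\<And>Y x. Y \<in> End \<Longrightarrow> S (Y x) = \<sigma> Y (S x)"
    using automorphism_intertwiner[OF \<sigma>(1) e f] by blast
  \<comment> \<open>\<open>S (e i)\<close> is a nonzero multiple of \<open>f i\<close>, and \<open>As\<close> acts on it by both scalars.\<close>
  have dual: "\<theta> i = \<theta>s i" if i: "i \<le> d" for i
  proof -
    have "e i = E i (e i)"
      using E e i by (simp add: ordered_eigenbasis_def coord_basis)
    then have "S (e i) = Es i (S (e i))"
      using S_inter[OF E_End[OF i]] \<sigma>(4)[OF i] by metis
    then obtain k where k: "S (e i) = scale k (f i)"
      using Es i by (auto simp: ordered_eigenbasis_def)
    have "scale (\<theta> i) (S (e i)) = As (S (e i))"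
      using S_inter[OF A, of "e i"] S(1) \<sigma>(2) by (simp add: A_e[OF i] End_scale)
    also have "\<dots> = scale (\<theta>s i) (S (e i))"
      using As by (simp add: k End_scale As_f[OF i] mult.commute)
    finally have "scale (\<theta> i) (S (e i)) = scale (\<theta>s i) (S (e i))" .
    moreover have "S (e i) \<noteq> 0"
      using indexed_basis_nonzero[OF e i] bij_is_inj[OF S(2)] End_zero[OF S(1)]
      by (metis injD)
    ultimately show ?thesis
      by (simp add: V.scale_right_imp_eq)
  qed
  have "S (As x) = A (S x)" for x
    using S_inter[OF As] \<sigma>(3) by simp
  then obtain c where c: "c \<noteq> 0" and T: "\<And>x. T x = scale c (S x)"
    using duality_map_multiple_of_intertwiner[OF E[unfolded \<theta>_def] Es[unfolded \<theta>s_def]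
        \<theta>_def \<theta>s_def dual S(1) _ S(3)]
    unfolding assms(5) by blast
  have T_End: "T \<in> End"
    using S(1) by (simp add: End_iff T V.scale_right_distrib mult.commute)
  have "inj T"
    using c bij_is_inj[OF S(2)] by (auto simp: inj_def T)
  have "surj T"
  proof (rule surjI)
    show "T (inv S (scale (inverse c) x)) = x" for x
      using c bij_is_surj[OF S(2)] by (simp add: T surj_f_inv_f)
  qed
  have T_range: "T ` range Y = range (\<sigma> Y)" if "Y \<in> End" "\<sigma> Y \<in> End" for Y
  proof -
    have "T \<circ> Y = \<sigma> Y \<circ> T"
      using that S_inter by (auto simp: T End_scale)
    then have "T ` range Y = \<sigma> Y ` range T"
      by (metis image_comp)
    then show ?thesis
      using \<open>surj T\<close> by simp
  qed
  have TE: "T ` range (E i) = range (Es i)" and TEs: "T ` range (Es i) = range (E i)" if "i \<le> d" for i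
    using T_range[of "E i"] T_range[of "Es i"] that by (simp_all add: E_End Es_End \<sigma>)
  have T_flag: "T ` flag_of d E Es L0 i = flag_of d E Es L0s i"
    "T ` flag_of d E Es LD i = flag_of d E Es LDs i"
    "T ` flag_of d E Es L0s i = flag_of d E Es L0 i"
    "T ` flag_of d E Es LDs i = flag_of d E Es LD i" if "i \<le> d" for i
    unfolding flag_of.simps image_induced_flag[OF T_End]
    by (intro induced_flag_cong, use that in \<open>simp add: TE TEs\<close>)+
  have dec: "dec z w i = flag_of d E Es z i \<inter> flag_of d E Es w (d - i)" if "i \<le> d" "z \<noteq> w" for z w i
  proof -
    obtain u where "adapted_basis d u (flag_of d E Es z) (flag_of d E Es w)"
      using flags_mutually_opposite[of E Es, OF _ _ \<open>z \<noteq> w\<close>] ordered_eigenbasis_range E Es by blast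
    then show ?thesis
      using that(1) by (simp add: assms(6) decomp_def induced_decomposition_inter)
  qed
  show ?thesis
    by (simp add: dec image_Int[OF \<open>inj T\<close>] T_flag del: flag_of.simps)
qed

end
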